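(* Let $(\mathcal{P}^{\text{co}}_{\mathcal{E}_t})_{t\ge 0}$ be the sequence of DIPK belief sets on $(\Omega,\mathcal{F})$ defined in the context, with lower and upper probabilities $\underline{P}_{\mathcal{E}_t},\overline{P}_{\mathcal{E}_t}$ and generalized Bayes' conditional lower and upper probabilities $\underline{P}^B_{\mathcal{E}_t},\overline{P}^B_{\mathcal{E}_t}$. Let $t\in\mathbb{N}$ and $A\in\mathcal{F}$. If $$\sum_{E_j\in\mathcal{E}_t}\underline{P}^B_{\mathcal{E}_{t-1}}(A\mid E_j)\left[\beta(n_t)\underline{P}_{\mathcal{E}_{t-1}}(E_j)+(1-\beta(n_t))P^{emp}_t(E_j)\right]\ >\ \overline{P}_{\mathcal{E}_{t-1}}(A)$$ or $$\sum_{E_j\in\mathcal{E}_t}\overline{P}^B_{\mathcal{E}_{t-1}}(A\mid E_j)\left[\beta(n_t)\overline{P}_{\mathcal{E}_{t-1}}(E_j)+(1-\beta(n_t))P^{emp}_t(E_j)\right]\ <\ \underline{P}_{\mathcal{E}_{t-1}}(A),$$ then $\mathcal{P}^{\text{co}}_{\mathcal{E}_t}$ exhibits DIPK-sure loss with respect to $\mathcal{P}^{\text{co}}_{\mathcal{E}_{t-1}}$ for $A$.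
   Context: $\Omega$ is at most countable, $\mathcal{F}=2^\Omega$, $\Delta(\Omega,\mathcal{F})$ is the set of probability measures on $(\Omega,\mathcal{F})$, $X:\Omega\to\mathcal{X}$ is a function, $(x_i)_{i\ge1}$ is a sequence of data points in $X(\Omega)$, $0=n_0<n_1<n_2<\cdots$ are integers, $\beta$ takes values in $[0,1]$, $\mathbb{N}=\{1,2,\dots\}$. DPK update of a measure. At time $t\ge 1$ the data $x_1,\dots,x_{n_t}$ are available. Let $E_1,\dots,E_m$ be the distinct sets among $X^{-1}(x_1),\dots,X^{-1}(x_{n_t})$, $E_{m+1}=\Omega\setminus\bigcup_{j=1}^m E_j$, and $\mathcal{E}_t=\{E_1,\dots,E_{m+1}\}$. If $E_{m+1}\ne\emptyset$, $P^{emp}_t(E_j)=\frac{1}{n_t+1}\#\{i\le n_t: X^{-1}(x_i)=E_j\}$ for $j\le m$ and $P^{emp}_t(E_{m+1})=1-\sum_{j=1}^m P^{emp}_t(E_j)$; if $E_{m+1}=\emptyset$, $P^{emp}_t(E_j)=\frac{1}{n_t}\#\{i\le n_t: X^{-1}(x_i)=E_j\}$ for $j\le m$ and $P^{emp}_t(E_{m+1})=0$. The time-$t$ DPK update of $P_{\mathcal{E}_{t-1}}\in\Delta(\Omega,\mathcal{F})$ is $P_{\mathcal{E}_t}(A)=\sum_{E_j\in\mathcal{E}_t}P_{\mathcal{E}_{t-1}}(A\mid E_j)P_{\mathcal{E}_t}(E_j)$, $A\in\mathcal{F}$, with $P_{\mathcal{E}_t}(E_j)=\beta(n_t)P_{\mathcal{E}_{t-1}}(E_j)+[1-\beta(n_t)]P^{emp}_t(E_j)$.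 Terms with $E_j=\emptyset$ are $0$ in all sums. DIPK. The agent specifies a set $\mathcal{P}\subset\Delta(\Omega,\mathcal{F})$ with lower probability $\underline{P}(A)=\inf_{P\in\mathcal{P}}P(A)$. The initial belief set is $\mathcal{P}^{\text{co}}_{\mathcal{E}_0}=\text{core}(\underline{P})=\{P\in\Delta(\Omega,\mathcal{F}):P(A)\ge\underline{P}(A)\ \forall A\in\mathcal{F}\}$, and $\mathcal{P}_{\mathcal{E}_0}$ is its set of extreme points, assumed finite, with $\mathcal{P}^{\text{co}}_{\mathcal{E}_0}=\text{Conv}(\mathcal{P}_{\mathcal{E}_0})$ and with every $P\in\mathcal{P}_{\mathcal{E}_0}$ positive on all nonempty events. For $t\ge1$, $\mathcal{P}_{\mathcal{E}_t}$ is the set of time-$t$ DPK updates of the elements of $\mathcal{P}_{\mathcal{E}_{t-1}}$, and $\mathcal{P}^{\text{co}}_{\mathcal{E}_t}=\text{Conv}(\mathcal{P}_{\mathcal{E}_t})$ (convex hull). Put $\underline{P}_{\mathcal{E}_t}(A)=\inf_{P\in\mathcal{P}^{\text{co}}_{\mathcal{E}_t}}P(A)$ and $\overline{P}_{\mathcal{E}_t}(A)=\sup_{P\in\mathcal{P}^{\text{co}}_{\mathcal{E}_t}}P(A)=1-\underline{P}_{\mathcal{E}_t}(A^c)$. Generalized Bayes' conditional lower and upper probabilities: $\underline{P}^B_{\mathcal{E}_t}(A\mid E)=\inf_{P\in\mathcal{P}^{\text{co}}_{\mathcal{E}_t}}\frac{P(A\cap E)}{P(E)}$ and $\overline{P}^B_{\mathcal{E}_t}(A\mid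 E)=\sup_{P\in\mathcal{P}^{\text{co}}_{\mathcal{E}_t}}\frac{P(A\cap E)}{P(E)}$. $\mathcal{P}^{\text{co}}_{\mathcal{E}_t}$ exhibits DIPK-sure loss with respect to $\mathcal{P}^{\text{co}}_{\mathcal{E}_{t-1}}$ for $A$ if $\underline{P}_{\mathcal{E}_t}(A)>\overline{P}_{\mathcal{E}_{t-1}}(A)$ or $\overline{P}_{\mathcal{E}_t}(A)<\underline{P}_{\mathcal{E}_{t-1}}(A)$. *)

theory Defs
  imports "HOL-Probability.Probability"
begin

definition prob_measures :: "'a set \<Rightarrow> 'a measure set" where
  "prob_measures \<Omega> = {P. prob_space P \<and> space P = \<Omega> \<and> sets P = Pow \<Omega>}"

definition lower_prob :: "'a measure set \<Rightarrow> 'a set \<Rightarrow> real" where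
  "lower_prob \<P> A = (INF P\<in>\<P>. measure P A)"

definition upper_prob :: "'a measure set \<Rightarrow> 'a set \<Rightarrow> real" where
  "upper_prob \<P> A = (SUP P\<in>\<P>. measure P A)"

definition core :: "'a set \<Rightarrow> ('a set \<Rightarrow> real) \<Rightarrow> 'a measure set" where
  "core \<Omega> \<nu> = {P \<in> prob_measures \<Omega>. \<forall>A\<in>Pow \<Omega>. \<nu> A \<le> measure P A}"

definition bayes_lower :: "'a measure set \<Rightarrow> 'a set \<Rightarrow> 'a set \<Rightarrow> real" where
  "bayes_lower \<P> A E = (INF P\<in>\<P>. measure P (A \<inter> E) / measure P E)"

definition bayes_upper :: "'a measure set \<Rightarrow> 'a set \<Rightarrow> 'a set \<Rightarrow> real" where
  "bayes_upper \<P> A E = (SUP P\<in>\<P>. measure P (A \<inter> E) / measure P E)"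

text \<open>
  The type of measures is not a real vector space, so the library notions of extreme point
  and convex hull do not apply; the two definitions below are their setwise counterparts.
\<close>

definition extreme_measures :: "'a measure set \<Rightarrow> 'a measure set" where
  "extreme_measures C = {P \<in> C. \<not> (\<exists>Q\<in>C. \<exists>R\<in>C. Q \<noteq> R \<and>
     (\<exists>u. 0 < u \<and> u < 1 \<and>
       (\<forall>A\<in>sets P. measure P A = (1 - u) * measure Q A + u * measure R A)))}"

definition convex_hull_measures :: "'a set \<Rightarrow> 'a measure set \<Rightarrow> 'a measure set" where
  "convex_hull_measures \<Omega> S = {P \<in> prob_measures \<Omega>. \<exists>T w. finite T \<and> T \<subseteq> S \<and>
     (\<forall>Q\<in>T. 0 \<le> w Q) \<and> (\<Sum>Q\<in>T. w Q) = 1 \<and>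
     (\<forall>A\<in>Pow \<Omega>. measure P A = (\<Sum>Q\<in>T. w Q * measure Q A))}"

text \<open>
  Throughout, \<open>x 1, \<dots>, x N\<close> are the data available at the time of the update
  (the value \<open>x 0\<close> is never used).
\<close>

definition data_cell :: "'a set \<Rightarrow> ('a \<Rightarrow> 'x) \<Rightarrow> 'x \<Rightarrow> 'a set" where
  "data_cell \<Omega> X y = X -` {y} \<inter> \<Omega>"

definition observed_cells :: "'a set \<Rightarrow> ('a \<Rightarrow> 'x) \<Rightarrow> (nat \<Rightarrow> 'x) \<Rightarrow> nat \<Rightarrow> 'a set set" where
  "observed_cells \<Omega> X x N = (\<lambda>i. data_cell \<Omega> X (x i)) ` {1..N}"

definition residual_cell :: "'a set \<Rightarrow> ('a \<Rightarrow> 'x) \<Rightarrow> (nat \<Rightarrow> 'x) \<Rightarrow> nat \<Rightarrow> 'a set" where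
  "residual_cell \<Omega> X x N = \<Omega> - \<Union>(observed_cells \<Omega> X x N)"

definition data_partition :: "'a set \<Rightarrow> ('a \<Rightarrow> 'x) \<Rightarrow> (nat \<Rightarrow> 'x) \<Rightarrow> nat \<Rightarrow> 'a set set" where
  "data_partition \<Omega> X x N = insert (residual_cell \<Omega> X x N) (observed_cells \<Omega> X x N)"

definition emp_freq :: "'a set \<Rightarrow> ('a \<Rightarrow> 'x) \<Rightarrow> (nat \<Rightarrow> 'x) \<Rightarrow> nat \<Rightarrow> 'a set \<Rightarrow> real" where
  "emp_freq \<Omega> X x N E =
     real (card {i \<in> {1..N}. data_cell \<Omega> X (x i) = E}) /
     (if residual_cell \<Omega> X x N \<noteq> {} then real N + 1 else real N)"

text \<open>Only the values of the following function on cells of the partition are meaningful.\<close>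

definition P_emp :: "'a set \<Rightarrow> ('a \<Rightarrow> 'x) \<Rightarrow> (nat \<Rightarrow> 'x) \<Rightarrow> nat \<Rightarrow> 'a set \<Rightarrow> real" where
  "P_emp \<Omega> X x N E =
     (if E \<in> observed_cells \<Omega> X x N then emp_freq \<Omega> X x N E
      else if residual_cell \<Omega> X x N \<noteq> {}
        then 1 - (\<Sum>F\<in>observed_cells \<Omega> X x N. emp_freq \<Omega> X x N F)
      else 0)"

text \<open>The empty cell, if present, is left out of all sums over the partition.\<close>

definition dpk_update ::
  "'a set \<Rightarrow> ('a \<Rightarrow> 'x) \<Rightarrow> (nat \<Rightarrow> 'x) \<Rightarrow> (nat \<Rightarrow> real) \<Rightarrow> nat \<Rightarrow> 'a measure \<Rightarrow> 'a measure" where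
  "dpk_update \<Omega> X x \<beta> N P = measure_of \<Omega> (Pow \<Omega>) (\<lambda>A. ennreal
     (\<Sum>E\<in>data_partition \<Omega> X x N - {{}}.
        cond_prob P (\<lambda>\<omega>. \<omega> \<in> A) (\<lambda>\<omega>. \<omega> \<in> E) *
        (\<beta> N * measure P E + (1 - \<beta> N) * P_emp \<Omega> X x N E)))"

text \<open>
  Here \<open>n t\<close> is the number of data available at time \<open>t\<close>.  The DPK update is applied
  to the members of the generating set only, not to those of its convex hull.
\<close>

primrec dipk_extremes ::
  "'a set \<Rightarrow> 'a measure set \<Rightarrow> ('a \<Rightarrow> 'x) \<Rightarrow> (nat \<Rightarrow> 'x) \<Rightarrow> (nat \<Rightarrow> real) \<Rightarrow> (nat \<Rightarrow> nat) \<Rightarrow> nat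
    \<Rightarrow> 'a measure set" where
  "dipk_extremes \<Omega> \<P> X x \<beta> n 0 = extreme_measures (core \<Omega> (lower_prob \<P>))"
| "dipk_extremes \<Omega> \<P> X x \<beta> n (Suc t) =
     dpk_update \<Omega> X x \<beta> (n (Suc t)) ` dipk_extremes \<Omega> \<P> X x \<beta> n t"

definition dipk_belief ::
  "'a set \<Rightarrow> 'a measure set \<Rightarrow> ('a \<Rightarrow> 'x) \<Rightarrow> (nat \<Rightarrow> 'x) \<Rightarrow> (nat \<Rightarrow> real) \<Rightarrow> (nat \<Rightarrow> nat) \<Rightarrow> nat
    \<Rightarrow> 'a measure set" where
  "dipk_belief \<Omega> \<P> X x \<beta> n t =
     (if t = 0 then core \<Omega> (lower_prob \<P>)
      else convex_hull_measures \<Omega> (dipk_extremes \<Omega> \<P> X x \<beta> n t))"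

definition dipk_sure_loss :: "'a measure set \<Rightarrow> 'a measure set \<Rightarrow> 'a set \<Rightarrow> bool" where
  "dipk_sure_loss new old A \<longleftrightarrow>
     lower_prob new A > upper_prob old A \<or> upper_prob new A < lower_prob old A"

end

theory Submission
  imports Defs
begin

text \<open>
  Every member of the new belief set is a mixture of DPK updates of generators of the old one,
  and the update of a generator \<open>R\<close> has
  \<open>Q A = (\<Sum>E. R (A | E) * (\<beta> * R E + (1 - \<beta>) * P_emp E))\<close>.  Since \<open>R\<close> itself belongs to the
  old belief set, \<open>R (A | E)\<close> and \<open>R E\<close> lie between the lower and upper values taken over that
  set; all factors are nonnegative, so \<open>Q A\<close> lies between the two sums in the hypothesis
  (\<open>dpk_update_bounds\<close>).  These bounds survive mixing (\<open>convex_hull_measures_bounds\<close>), and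
  therefore hold for the lower and upper probabilities of the new belief set.  If the smaller sum
  exceeds the old upper probability, or the larger one falls short of the old lower probability,
  there is sure loss.

  The delicate point is that the generators remain probability measures, because only then do
  they belong to the convex hull that they generate.  The weights of an update sum to one because
  the empirical distribution is a probability distribution on the partition, but a cell with
  \<open>R E = 0\<close> would lose its weight through \<open>R (\<Omega> | E) = 0 / 0 = 0\<close>.  The invariant
  carried along the sequence is therefore positivity on all nonempty events
  (\<open>dpk_update_full_support\<close>).  It is preserved even for \<open>\<beta> = 0\<close>, since every nonempty cell has
  positive empirical mass: observed cells were seen, and a nonempty residual cell receives
  \<open>1 / (N + 1)\<close>.
\<close>

section \<open>Lower and upper envelopes\<close>

lemma prob_measures_measure_Pow:
  assumes "P \<in> prob_measures \<Omega>" "F \<subseteq> \<Omega>"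
  shows "F \<in> sets P" "0 \<le> measure P F" "measure P F \<le> 1"
  using assms prob_space.prob_le_1[of P] by (auto simp: prob_measures_def)

lemma prob_measures_ratio_le_1:
  assumes "P \<in> prob_measures \<Omega>" "E \<subseteq> \<Omega>"
  shows "measure P (A \<inter> E) / measure P E \<le> 1"
proof -
  interpret prob_space P using assms(1) by (simp add: prob_measures_def)
  have "measure P (A \<inter> E) \<le> measure P E"
    by (rule finite_measure_mono) (use assms in \<open>auto simp: prob_measures_def\<close>)
  then show ?thesis by (simp add: divide_le_eq_1 zero_less_measure_iff)
qed

lemma lower_prob_le_measure:
  assumes "P \<in> S"
  shows "lower_prob S F \<le> measure P F"
  unfolding lower_prob_def
  by (rule cINF_lower[OF _ assms]) (auto intro!: bdd_belowI[of _ 0])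

lemma measure_le_upper_prob:
  assumes "S \<subseteq> prob_measures \<Omega>" "P \<in> S" "F \<subseteq> \<Omega>"
  shows "measure P F \<le> upper_prob S F"
  unfolding upper_prob_def
  by (rule cSUP_upper[OF assms(2)])
    (use assms(1,3) in \<open>auto intro!: bdd_aboveI[of _ 1] prob_measures_measure_Pow(3)\<close>)

lemma lower_prob_nonneg:
  assumes "S \<noteq> {}"
  shows "0 \<le> lower_prob S F"
  unfolding lower_prob_def using assms by (auto intro: cINF_greatest)

lemma bayes_lower_le_ratio:
  assumes "P \<in> S"
  shows "bayes_lower S A E \<le> measure P (A \<inter> E) / measure P E"
  unfolding bayes_lower_def
  by (rule cINF_lower[OF _ assms]) (auto intro!: bdd_belowI[of _ 0])

lemma ratio_le_bayes_upper:
  assumes "S \<subseteq> prob_measures \<Omega>" "P \<in> S" "E \<subseteq> \<Omega>"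
  shows "measure P (A \<inter> E) / measure P E \<le> bayes_upper S A E"
  unfolding bayes_upper_def
  by (rule cSUP_upper[OF assms(2)])
    (use assms(1,3) in \<open>auto intro!: bdd_aboveI[of _ 1] prob_measures_ratio_le_1\<close>)

lemma bayes_lower_nonneg:
  assumes "S \<noteq> {}"
  shows "0 \<le> bayes_lower S A E"
  unfolding bayes_lower_def using assms by (auto intro: cINF_greatest)

lemma subset_core_lower_prob:
  assumes "S \<subseteq> prob_measures \<Omega>"
  shows "S \<subseteq> core \<Omega> (lower_prob S)"
  using assms lower_prob_le_measure by (auto simp: core_def)

lemma convex_hull_measures_incl:
  assumes "P \<in> S" "P \<in> prob_measures \<Omega>"
  shows "P \<in> convex_hull_measures \<Omega> S"
proof -
  let ?w = "\<lambda>_. 1::real"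
  have "finite {P} \<and> {P} \<subseteq> S \<and> (\<forall>Q\<in>{P}. 0 \<le> ?w Q) \<and> (\<Sum>Q\<in>{P}. ?w Q) = 1 \<and>
      (\<forall>A\<in>Pow \<Omega>. measure P A = (\<Sum>Q\<in>{P}. ?w Q * measure Q A))"
    using assms(1) by simp
  then have "\<exists>T w. finite T \<and> T \<subseteq> S \<and> (\<forall>Q\<in>T. 0 \<le> w Q) \<and> (\<Sum>Q\<in>T. w Q) = 1 \<and>
      (\<forall>A\<in>Pow \<Omega>. measure P A = (\<Sum>Q\<in>T. w Q * measure Q A))"
    by (rule exI[of _ "{P}", OF exI[of _ ?w]])
  with assms(2) show ?thesis
    by (simp add: convex_hull_measures_def)
qed

lemma convex_hull_measures_empty: "convex_hull_measures \<Omega> {} = {}"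
  by (auto simp: convex_hull_measures_def)

lemma convex_hull_measures_bounds:
  assumes "P \<in> convex_hull_measures \<Omega> S" "A \<subseteq> \<Omega>"
    and bounds: "\<And>Q. Q \<in> S \<Longrightarrow> a \<le> measure Q A" "\<And>Q. Q \<in> S \<Longrightarrow> measure Q A \<le> b"
  shows "a \<le> measure P A" "measure P A \<le> b"
proof -
  obtain T w where T: "T \<subseteq> S" "\<And>Q. Q \<in> T \<Longrightarrow> 0 \<le> w Q" "(\<Sum>Q\<in>T. w Q) = 1"
    and P: "measure P A = (\<Sum>Q\<in>T. w Q * measure Q A)"
    using assms(1,2) unfolding convex_hull_measures_def mem_Collect_eq by (metis PowI)
  have "(\<Sum>Q\<in>T. w Q * a) \<le> measure P A" "measure P A \<le> (\<Sum>Q\<in>T. w Q * b)"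
    unfolding P using T(1,2) bounds by (intro sum_mono mult_left_mono; blast)+
  then show "a \<le> measure P A" "measure P A \<le> b"
    using T(3) by (simp_all flip: sum_distrib_right)
qed

section \<open>The data partition and the empirical distribution\<close>

lemma finite_data_partition: "finite (data_partition \<Omega> X x N)"
  by (simp add: data_partition_def observed_cells_def)

lemma data_partition_subset: "E \<in> data_partition \<Omega> X x N \<Longrightarrow> E \<subseteq> \<Omega>"
  by (auto simp: data_partition_def observed_cells_def residual_cell_def data_cell_def)

lemma Union_data_partition: "\<Union>(data_partition \<Omega> X x N - {{}}) = \<Omega>"
proof -
  have "\<Union>(data_partition \<Omega> X x N - {{}}) = \<Union>(data_partition \<Omega> X x N)"
    by blast
  moreover have "\<Union>(observed_cells \<Omega> X x N) \<subseteq> \<Omega>"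
    by (auto simp: observed_cells_def data_cell_def)
  ultimately show ?thesis
    unfolding data_partition_def residual_cell_def by blast
qed

lemma disjoint_data_partition: "disjoint (data_partition \<Omega> X x N)"
  by (auto simp: data_partition_def observed_cells_def residual_cell_def data_cell_def
      disjoint_def)

lemma empty_notin_observed_cells:
  assumes "\<And>i. i \<ge> 1 \<Longrightarrow> x i \<in> X ` \<Omega>"
  shows "{} \<notin> observed_cells \<Omega> X x N"
  using assms by (fastforce simp: observed_cells_def data_cell_def)

lemma residual_cell_observed_imp_empty:
  "residual_cell \<Omega> X x N \<in> observed_cells \<Omega> X x N \<Longrightarrow> residual_cell \<Omega> X x N = {}"
  by (auto simp: residual_cell_def)

lemma sum_emp_freq:
  "(\<Sum>E\<in>observed_cells \<Omega> X x N. emp_freq \<Omega> X x N E) =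
    real N / (if residual_cell \<Omega> X x N \<noteq> {} then real N + 1 else real N)"
proof -
  have "(\<Sum>E\<in>observed_cells \<Omega> X x N. card {i \<in> {1..N}. data_cell \<Omega> X (x i) = E}) = N"
    using sum.image_gen[of "{1..N}" "\<lambda>_. 1::nat" "\<lambda>i. data_cell \<Omega> X (x i)"]
    by (simp add: observed_cells_def)
  then show ?thesis
    by (simp add: emp_freq_def flip: sum_divide_distrib of_nat_sum)
qed

lemma P_emp_residual:
  assumes "residual_cell \<Omega> X x N \<noteq> {}"
  shows "P_emp \<Omega> X x N (residual_cell \<Omega> X x N) = 1 / (real N + 1)"
proof -
  have "residual_cell \<Omega> X x N \<notin> observed_cells \<Omega> X x N"
    using assms residual_cell_observed_imp_empty by metis
  then show ?thesis
    using assms by (simp add: P_emp_def sum_emp_freq field_simps)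
qed

lemma P_emp_pos:
  assumes "E \<in> data_partition \<Omega> X x N - {{}}"
  shows "0 < P_emp \<Omega> X x N E"
proof (cases "E \<in> observed_cells \<Omega> X x N")
  case True
  then obtain i where i: "i \<in> {1..N}" "data_cell \<Omega> X (x i) = E"
    by (auto simp: observed_cells_def)
  then have "0 < card {i \<in> {1..N}. data_cell \<Omega> X (x i) = E}"
    by (auto simp: card_gt_0_iff)
  then show ?thesis
    using True i(1) by (simp add: P_emp_def emp_freq_def)
next
  case False
  then have "E = residual_cell \<Omega> X x N" "residual_cell \<Omega> X x N \<noteq> {}"
    using assms unfolding data_partition_def by blast+
  then show ?thesis
    using P_emp_residual[of \<Omega> X x N] by simp
qed

lemma sum_P_emp:
  assumes "\<And>i. i \<ge> 1 \<Longrightarrow> x i \<in> X ` \<Omega>" "N \<ge> 1"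
  shows "(\<Sum>E\<in>data_partition \<Omega> X x N - {{}}. P_emp \<Omega> X x N E) = 1"
proof -
  let ?O = "observed_cells \<Omega> X x N" and ?r = "residual_cell \<Omega> X x N"
  have fin: "finite ?O" by (simp add: observed_cells_def)
  have ne: "{} \<notin> ?O" using empty_notin_observed_cells assms(1) by metis
  have obs: "(\<Sum>E\<in>?O. P_emp \<Omega> X x N E) = (\<Sum>E\<in>?O. emp_freq \<Omega> X x N E)"
    by (simp add: P_emp_def)
  show ?thesis
  proof (cases "?r = {}")
    case True
    then have "data_partition \<Omega> X x N - {{}} = ?O"
      using ne by (auto simp: data_partition_def)
    then show ?thesis using obs True assms(2) by (simp add: sum_emp_freq)
  next
    case False
    then have "?r \<notin> ?O"
      using residual_cell_observed_imp_empty by metis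
    moreover have "data_partition \<Omega> X x N - {{}} = insert ?r ?O"
      using ne False unfolding data_partition_def by blast
    ultimately show ?thesis
      using obs False fin by (simp add: sum_emp_freq P_emp_residual add_divide_distrib[symmetric])
  qed
qed

section \<open>The DPK update as a measure\<close>

definition full_support_measures :: "'a set \<Rightarrow> 'a measure set" where
  "full_support_measures \<Omega> =
     {P \<in> prob_measures \<Omega>. \<forall>F. F \<subseteq> \<Omega> \<longrightarrow> F \<noteq> {} \<longrightarrow> measure P F > 0}"

definition dpk_weight ::
  "'a set \<Rightarrow> ('a \<Rightarrow> 'x) \<Rightarrow> (nat \<Rightarrow> 'x) \<Rightarrow> (nat \<Rightarrow> real) \<Rightarrow> nat \<Rightarrow> 'a measure \<Rightarrow> 'a set \<Rightarrow> real" where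
  "dpk_weight \<Omega> X x \<beta> N P E = \<beta> N * measure P E + (1 - \<beta> N) * P_emp \<Omega> X x N E"

lemma dpk_weight_nonneg:
  assumes "\<beta> N \<in> {0..1}" "E \<in> data_partition \<Omega> X x N - {{}}"
  shows "0 \<le> dpk_weight \<Omega> X x \<beta> N P E"
  using assms P_emp_pos[OF assms(2)] by (simp add: dpk_weight_def)

lemma dpk_weight_pos:
  assumes "P \<in> full_support_measures \<Omega>" "\<beta> N \<in> {0..1}" "E \<in> data_partition \<Omega> X x N - {{}}"
  shows "0 < dpk_weight \<Omega> X x \<beta> N P E"
proof -
  have "0 < measure P E" "0 < P_emp \<Omega> X x N E"
    using assms(1,3) data_partition_subset[of E \<Omega> X x N] P_emp_pos[OF assms(3)]
    by (auto simp: full_support_measures_def)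
  \<comment> \<open>At least one of the two coefficients \<open>\<beta> N\<close> and \<open>1 - \<beta> N\<close> is positive.\<close>
  then show ?thesis
    using assms(2) by (cases "\<beta> N = 0") (auto simp: dpk_weight_def intro!: add_pos_nonneg)
qed

lemma sum_measure_data_partition:
  assumes "P \<in> prob_measures \<Omega>"
  shows "(\<Sum>E\<in>data_partition \<Omega> X x N - {{}}. measure P E) = 1"
proof -
  interpret prob_space P using assms by (simp add: prob_measures_def)
  let ?D = "data_partition \<Omega> X x N - {{}}"
  have "disjoint_family_on (\<lambda>E. E) ?D"
    using disjoint_data_partition[of \<Omega> X x N]
    by (auto simp: disjoint_family_on_def disjoint_def)
  moreover have "(\<lambda>E. E) ` ?D \<subseteq> events"
    using assms data_partition_subset[of _ \<Omega> X x N] by (auto simp: prob_measures_def)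
  ultimately have "prob (\<Union>E\<in>?D. E) = (\<Sum>E\<in>?D. prob E)"
    by (intro finite_measure_finite_Union) (auto simp: finite_data_partition)
  then show ?thesis
    using assms prob_space by (simp add: Union_data_partition prob_measures_def)
qed

lemma sum_dpk_weight:
  assumes "P \<in> prob_measures \<Omega>" "\<And>i. i \<ge> 1 \<Longrightarrow> x i \<in> X ` \<Omega>" "N \<ge> 1"
  shows "(\<Sum>E\<in>data_partition \<Omega> X x N - {{}}. dpk_weight \<Omega> X x \<beta> N P E) = 1"
proof -
  let ?D = "data_partition \<Omega> X x N - {{}}"
  have "(\<Sum>E\<in>?D. dpk_weight \<Omega> X x \<beta> N P E) =
      \<beta> N * (\<Sum>E\<in>?D. measure P E) + (1 - \<beta> N) * (\<Sum>E\<in>?D. P_emp \<Omega> X x N E)"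
    by (simp add: dpk_weight_def sum.distrib sum_distrib_left)
  moreover have "(\<Sum>E\<in>?D. measure P E) = 1"
    by (rule sum_measure_data_partition[OF assms(1)])
  moreover have "(\<Sum>E\<in>?D. P_emp \<Omega> X x N E) = 1"
    by (rule sum_P_emp[OF assms(2,3)])
  ultimately show ?thesis by simp
qed

lemma countably_additive_sum_restrictions:
  fixes c :: "'a set \<Rightarrow> real"
  assumes "P \<in> prob_measures \<Omega>" "\<And>E. E \<in> I \<Longrightarrow> 0 \<le> c E"
  shows "countably_additive (Pow \<Omega>) (\<lambda>A. ennreal (\<Sum>E\<in>I. measure P (A \<inter> E) * c E))"
proof (rule countably_additiveI)
  fix A :: "nat \<Rightarrow> 'a set"
  assume A: "range A \<subseteq> Pow \<Omega>" "disjoint_family A"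
  interpret prob_space P using assms(1) by (simp add: prob_measures_def)
  have split: "ennreal (\<Sum>E\<in>I. measure P (B \<inter> E) * c E) = (\<Sum>E\<in>I. emeasure P (B \<inter> E) * c E)"
    for B
    using assms(2) by (subst sum_ennreal[symmetric])
      (auto simp: emeasure_eq_measure ennreal_mult intro!: sum.cong)
  have "(\<Sum>i. emeasure P (A i \<inter> E)) = emeasure P ((\<Union>i. A i) \<inter> E)" for E
  proof -
    have "(\<Sum>i. emeasure P (A i \<inter> E)) = emeasure P (\<Union>i. A i \<inter> E)"
      by (rule suminf_emeasure)
        (use A assms(1) in
          \<open>auto simp: prob_measures_def intro!: disjoint_family_on_bisimulation[OF A(2)]\<close>)
    also have "(\<Union>i. A i \<inter> E) = (\<Union>i. A i) \<inter> E" by auto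
    finally show ?thesis .
  qed
  then show "(\<Sum>i. ennreal (\<Sum>E\<in>I. measure P (A i \<inter> E) * c E)) =
      ennreal (\<Sum>E\<in>I. measure P ((\<Union>i. A i) \<inter> E) * c E)"
    unfolding split by (subst suminf_sum) auto
qed

text \<open>
  A finite combination of the restrictions \<open>A \<mapsto> P (A \<inter> E)\<close> with nonnegative coefficients is
  countably additive, so the measure built by the update really takes the values of the defining
  formula and does not degenerate to the default null measure.
\<close>

lemma measure_dpk_update:
  assumes "P \<in> prob_measures \<Omega>" "\<beta> N \<in> {0..1}" "A \<subseteq> \<Omega>"
  shows "measure (dpk_update \<Omega> X x \<beta> N P) A =
    (\<Sum>E\<in>data_partition \<Omega> X x N - {{}}.
      measure P (A \<inter> E) / measure P E * dpk_weight \<Omega> X x \<beta> N P E)"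
proof -
  let ?D = "data_partition \<Omega> X x N - {{}}" and ?w = "dpk_weight \<Omega> X x \<beta> N P"
  let ?f = "\<lambda>A. \<Sum>E\<in>?D. cond_prob P (\<lambda>\<omega>. \<omega> \<in> A) (\<lambda>\<omega>. \<omega> \<in> E) * ?w E"
  let ?g = "\<lambda>A. \<Sum>E\<in>?D. measure P (A \<inter> E) * (?w E / measure P E)"
  have fg: "?f B = ?g B" for B
  proof (rule sum.cong)
    fix E assume E: "E \<in> ?D"
    then have "{\<omega> \<in> space P. \<omega> \<in> B \<and> \<omega> \<in> E} = B \<inter> E" "{\<omega> \<in> space P. \<omega> \<in> E} = E"
      using assms(1) data_partition_subset[of E \<Omega> X x N] by (auto simp: prob_measures_def)
    then show "cond_prob P (\<lambda>\<omega>. \<omega> \<in> B) (\<lambda>\<omega>. \<omega> \<in> E) * ?w E =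
        measure P (B \<inter> E) * (?w E / measure P E)"
      by (simp add: cond_prob_def)
  qed simp
  have c: "0 \<le> ?w E / measure P E" if "E \<in> ?D" for E
    using dpk_weight_nonneg[of \<beta> N, OF assms(2) that] by simp
  have upd: "dpk_update \<Omega> X x \<beta> N P = measure_of \<Omega> (Pow \<Omega>) (\<lambda>A. ennreal (?g A))"
    unfolding dpk_update_def using fg by (simp add: dpk_weight_def)
  have sets: "sets (dpk_update \<Omega> X x \<beta> N P) = Pow \<Omega>"
    by (simp add: upd sigma_algebra.sigma_sets_eq[OF sigma_algebra_Pow])
  have "emeasure (dpk_update \<Omega> X x \<beta> N P) A = ennreal (?g A)"
    by (rule emeasure_measure_of[OF upd])
      (use assms(3) countably_additive_sum_restrictions[OF assms(1), of ?D, OF c]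
        in \<open>auto simp: sets positive_def\<close>)
  moreover have "0 \<le> ?g A" using c by (intro sum_nonneg mult_nonneg_nonneg) auto
  ultimately have "measure (dpk_update \<Omega> X x \<beta> N P) A = ?g A"
    by (simp add: measure_def)
  then show ?thesis by simp
qed

text \<open>
  Positivity of \<open>P\<close> on the cells makes every conditional probability \<open>P (\<Omega> | E)\<close> equal to one, so
  the total mass is the sum of the weights.  A nonempty event meets some cell, and that cell alone
  already contributes a positive amount.
\<close>

lemma dpk_update_full_support:
  assumes P: "P \<in> full_support_measures \<Omega>" and \<beta>: "\<beta> N \<in> {0..1}"
    and data: "\<And>i. i \<ge> 1 \<Longrightarrow> x i \<in> X ` \<Omega>" and N: "N \<ge> 1"
  shows "dpk_update \<Omega> X x \<beta> N P \<in> full_support_measures \<Omega>"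
proof -
  let ?D = "data_partition \<Omega> X x N - {{}}" and ?w = "dpk_weight \<Omega> X x \<beta> N P"
    and ?U = "dpk_update \<Omega> X x \<beta> N P"
  have prob: "P \<in> prob_measures \<Omega>"
    and pos: "\<And>F. F \<subseteq> \<Omega> \<Longrightarrow> F \<noteq> {} \<Longrightarrow> 0 < measure P F"
    using P by (auto simp: full_support_measures_def)
  note meas = measure_dpk_update[where \<beta> = \<beta> and N = N, OF prob \<beta>]
  have space: "space ?U = \<Omega>" and sets: "sets ?U = Pow \<Omega>"
    by (simp_all add: dpk_update_def sigma_algebra.sigma_sets_eq[OF sigma_algebra_Pow])
  have "measure ?U \<Omega> = (\<Sum>E\<in>?D. ?w E)"
    unfolding meas[OF order_refl]
  proof (rule sum.cong)
    fix E assume "E \<in> ?D"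
    then have "E \<subseteq> \<Omega>" "E \<noteq> {}" using data_partition_subset[of E \<Omega> X x N] by auto
    moreover from this have "\<Omega> \<inter> E = E" by blast
    ultimately show "measure P (\<Omega> \<inter> E) / measure P E * ?w E = ?w E"
      using pos[of E] by simp
  qed simp
  then have "measure ?U (space ?U) = 1"
    using sum_dpk_weight[OF prob data N] by (simp add: space)
  then have "prob_space ?U"
    by (intro prob_spaceI) (metis emeasure_eq_ennreal_measure ennreal_1 measure_zero_top zero_neq_one)
  moreover have "0 < measure ?U F" if F: "F \<subseteq> \<Omega>" "F \<noteq> {}" for F
  proof -
    obtain E where E: "E \<in> ?D" "F \<inter> E \<noteq> {}"
      using F Union_data_partition[of \<Omega> X x N] by blast
    then have "E \<subseteq> \<Omega>" "E \<noteq> {}" using data_partition_subset[of E \<Omega> X x N] by auto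
    then have "0 < measure P (F \<inter> E) / measure P E * ?w E"
      using E F pos[of "F \<inter> E"] pos[of E] dpk_weight_pos[of P \<Omega> \<beta> N, OF P \<beta> E(1)]
      by (intro mult_pos_pos divide_pos_pos) blast+
    also have "\<dots> \<le> measure ?U F"
      unfolding meas[OF F(1)]
    proof (rule member_le_sum[OF E(1)])
      fix G assume "G \<in> ?D - {E}"
      then have "0 \<le> ?w G" by (intro dpk_weight_nonneg \<beta>) blast
      then show "0 \<le> measure P (F \<inter> G) / measure P G * ?w G" by simp
    qed (simp add: finite_data_partition)
    finally show ?thesis .
  qed
  ultimately show ?thesis
    using space sets by (simp add: full_support_measures_def prob_measures_def)
qed

text \<open>
  The bounds hold for a single update because they hold summand by summand: conditional
  probabilities and cell weights are nonnegative, so lowering or raising both factors lowers or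
  raises their product.
\<close>

lemma dpk_update_bounds:
  assumes S: "S \<subseteq> prob_measures \<Omega>" "P \<in> S" and \<beta>: "\<beta> N \<in> {0..1}" and A: "A \<subseteq> \<Omega>"
  shows "(\<Sum>E\<in>data_partition \<Omega> X x N - {{}}. bayes_lower S A E *
            (\<beta> N * lower_prob S E + (1 - \<beta> N) * P_emp \<Omega> X x N E))
         \<le> measure (dpk_update \<Omega> X x \<beta> N P) A" (is "?L \<le> _")
    and "measure (dpk_update \<Omega> X x \<beta> N P) A
         \<le> (\<Sum>E\<in>data_partition \<Omega> X x N - {{}}. bayes_upper S A E *
            (\<beta> N * upper_prob S E + (1 - \<beta> N) * P_emp \<Omega> X x N E))" (is "_ \<le> ?R")
proof -
  let ?D = "data_partition \<Omega> X x N - {{}}"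
  have ne: "S \<noteq> {}" using S by blast
  have P: "P \<in> prob_measures \<Omega>" using S by blast
  note meas = measure_dpk_update[where \<beta> = \<beta> and N = N, OF P \<beta> A]
  show "?L \<le> measure (dpk_update \<Omega> X x \<beta> N P) A"
    unfolding meas
  proof (rule sum_mono)
    fix E assume E: "E \<in> ?D"
    have emp: "0 < P_emp \<Omega> X x N E" using P_emp_pos E by metis
    have "\<beta> N * lower_prob S E + (1 - \<beta> N) * P_emp \<Omega> X x N E \<le> dpk_weight \<Omega> X x \<beta> N P E"
      unfolding dpk_weight_def
      using \<beta> lower_prob_le_measure[OF S(2)] by (intro add_right_mono mult_left_mono) auto
    moreover have "0 \<le> \<beta> N * lower_prob S E + (1 - \<beta> N) * P_emp \<Omega> X x N E"
      using \<beta> emp lower_prob_nonneg[OF ne] by simp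
    ultimately show "bayes_lower S A E * (\<beta> N * lower_prob S E + (1 - \<beta> N) * P_emp \<Omega> X x N E)
        \<le> measure P (A \<inter> E) / measure P E * dpk_weight \<Omega> X x \<beta> N P E"
      by (intro mult_mono bayes_lower_le_ratio[OF S(2)]) auto
  qed
  show "measure (dpk_update \<Omega> X x \<beta> N P) A \<le> ?R"
    unfolding meas
  proof (rule sum_mono)
    fix E assume E: "E \<in> ?D"
    then have sub: "E \<subseteq> \<Omega>" using data_partition_subset[of E \<Omega> X x N] by auto
    have "dpk_weight \<Omega> X x \<beta> N P E \<le> \<beta> N * upper_prob S E + (1 - \<beta> N) * P_emp \<Omega> X x N E"
      unfolding dpk_weight_def
      using \<beta> measure_le_upper_prob[OF S sub] by (intro add_right_mono mult_left_mono) auto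
    moreover have ratio: "measure P (A \<inter> E) / measure P E \<le> bayes_upper S A E"
      by (rule ratio_le_bayes_upper[OF S sub])
    moreover have "0 \<le> bayes_upper S A E"
      using order_trans[OF _ ratio] by simp
    ultimately show "measure P (A \<inter> E) / measure P E * dpk_weight \<Omega> X x \<beta> N P E
        \<le> bayes_upper S A E * (\<beta> N * upper_prob S E + (1 - \<beta> N) * P_emp \<Omega> X x N E)"
      using dpk_weight_nonneg[of \<beta> N, OF \<beta> E] by (intro mult_mono) auto
  qed
qed

section \<open>The DIPK sequence\<close>

lemma dipk_extremes_full_support:
  assumes "dipk_extremes \<Omega> \<P> X x \<beta> n 0 \<subseteq> full_support_measures \<Omega>"
    and "\<And>i. i \<ge> 1 \<Longrightarrow> x i \<in> X ` \<Omega>" and n: "strict_mono n"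
    and \<beta>: "\<And>k. k \<ge> 1 \<Longrightarrow> \<beta> k \<in> {0..1}"
  shows "dipk_extremes \<Omega> \<P> X x \<beta> n s \<subseteq> full_support_measures \<Omega>"
proof (induction s)
  case (Suc s)
  have "n (Suc s) \<ge> 1" using strict_monoD[OF n, of s "Suc s"] by simp
  then have "dpk_update \<Omega> X x \<beta> (n (Suc s)) P \<in> full_support_measures \<Omega>"
    if "P \<in> dipk_extremes \<Omega> \<P> X x \<beta> n s" for P
    using that Suc by (intro dpk_update_full_support assms(2) \<beta>) blast+
  then show ?case
    unfolding dipk_extremes.simps by blast
qed (rule assms(1))

lemma dipk_belief_subset_prob_measures: "dipk_belief \<Omega> \<P> X x \<beta> n s \<subseteq> prob_measures \<Omega>"
  by (auto simp: dipk_belief_def core_def convex_hull_measures_def)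

lemma dipk_extremes_subset_belief:
  assumes "dipk_extremes \<Omega> \<P> X x \<beta> n s \<subseteq> prob_measures \<Omega>"
  shows "dipk_extremes \<Omega> \<P> X x \<beta> n s \<subseteq> dipk_belief \<Omega> \<P> X x \<beta> n s"
proof (cases s)
  case 0
  then show ?thesis by (auto simp: dipk_belief_def extreme_measures_def)
next
  case (Suc r)
  then have "dipk_belief \<Omega> \<P> X x \<beta> n s = convex_hull_measures \<Omega> (dipk_extremes \<Omega> \<P> X x \<beta> n s)"
    by (simp add: dipk_belief_def)
  then show ?thesis
    using assms convex_hull_measures_incl by blast
qed

theorem proposition22:
  fixes \<Omega> :: "'a set"
    and \<P> :: "'a measure set"
    and X :: "'a \<Rightarrow> 'x"
    and x :: "nat \<Rightarrow> 'x"
    and \<beta> :: "nat \<Rightarrow> real"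
    and n :: "nat \<Rightarrow> nat"
    and t :: nat
    and A :: "'a set"
  defines "B \<equiv> dipk_belief \<Omega> \<P> X x \<beta> n"
    and "\<E> \<equiv> \<lambda>s. data_partition \<Omega> X x (n s)"
    and "Pemp \<equiv> \<lambda>s. P_emp \<Omega> X x (n s)"
  assumes "countable \<Omega>"
    and "\<P> \<subseteq> prob_measures \<Omega>" and "\<P> \<noteq> {}"
    and "\<And>i. i \<ge> 1 \<Longrightarrow> x i \<in> X ` \<Omega>"
    and "n 0 = 0" and "strict_mono n"
    and "\<And>k. k \<ge> 1 \<Longrightarrow> \<beta> k \<in> {0..1}"
    and "finite (dipk_extremes \<Omega> \<P> X x \<beta> n 0)"
    and "B 0 = convex_hull_measures \<Omega> (dipk_extremes \<Omega> \<P> X x \<beta> n 0)"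
    and "\<And>P F. P \<in> dipk_extremes \<Omega> \<P> X x \<beta> n 0 \<Longrightarrow> F \<subseteq> \<Omega> \<Longrightarrow> F \<noteq> {} \<Longrightarrow> measure P F > 0"
    and "t \<ge> 1" and "A \<subseteq> \<Omega>"
    and "(\<Sum>E\<in>\<E> t - {{}}. bayes_lower (B (t - 1)) A E *
            (\<beta> (n t) * lower_prob (B (t - 1)) E + (1 - \<beta> (n t)) * Pemp t E))
          > upper_prob (B (t - 1)) A
       \<or> (\<Sum>E\<in>\<E> t - {{}}. bayes_upper (B (t - 1)) A E *
            (\<beta> (n t) * upper_prob (B (t - 1)) E + (1 - \<beta> (n t)) * Pemp t E))
          < lower_prob (B (t - 1)) A"
  shows "dipk_sure_loss (B t) (B (t - 1)) A"
proof -
  let ?Ex = "dipk_extremes \<Omega> \<P> X x \<beta> n"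
  obtain s where t: "t = Suc s" using \<open>t \<ge> 1\<close> by (cases t) auto
  have "strict_mono n" by fact
  then have nt: "n t \<ge> 1" using strict_monoD[of n s t] by (simp add: t)
  have \<beta>: "\<beta> (n t) \<in> {0..1}" using nt assms(10) by blast
  have "?Ex 0 \<subseteq> full_support_measures \<Omega>"
    using assms(13) by (auto simp: full_support_measures_def extreme_measures_def core_def)
  then have "?Ex k \<subseteq> full_support_measures \<Omega>" for k
    using dipk_extremes_full_support assms(7,10) \<open>strict_mono n\<close> by metis
  then have prob: "?Ex k \<subseteq> prob_measures \<Omega>" for k
    by (auto simp: full_support_measures_def)
  then have incl: "?Ex k \<subseteq> B k" for k
    unfolding B_def by (rule dipk_extremes_subset_belief)
  \<comment> \<open>The core contains the specified set; being nonempty and the hull of its extreme points,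
    it has at least one.\<close>
  have "\<P> \<subseteq> B 0"
    using subset_core_lower_prob[OF assms(5)] by (simp add: B_def dipk_belief_def)
  then have "?Ex 0 \<noteq> {}"
    using assms(6,12) convex_hull_measures_empty by fastforce
  then have "?Ex k \<noteq> {}" for k by (induction k) auto
  then have ne: "B t \<noteq> {}" using incl by blast
  have Bs: "B s \<subseteq> prob_measures \<Omega>"
    unfolding B_def by (rule dipk_belief_subset_prob_measures)
  let ?L = "\<Sum>E\<in>\<E> t - {{}}. bayes_lower (B s) A E *
            (\<beta> (n t) * lower_prob (B s) E + (1 - \<beta> (n t)) * Pemp t E)"
  let ?R = "\<Sum>E\<in>\<E> t - {{}}. bayes_upper (B s) A E *
            (\<beta> (n t) * upper_prob (B s) E + (1 - \<beta> (n t)) * Pemp t E)"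
  have Q: "?L \<le> measure Q A" "measure Q A \<le> ?R" if "Q \<in> ?Ex t" for Q
  proof -
    have "Q \<in> dpk_update \<Omega> X x \<beta> (n t) ` ?Ex s"
      using that unfolding t dipk_extremes.simps .
    then obtain P where P: "P \<in> B s" "Q = dpk_update \<Omega> X x \<beta> (n t) P"
      using incl[of s] by blast
    show "?L \<le> measure Q A" "measure Q A \<le> ?R"
      unfolding P(2) \<E>_def Pemp_def
      using dpk_update_bounds[where \<beta> = \<beta> and N = "n t", OF Bs P(1) \<beta> \<open>A \<subseteq> \<Omega>\<close>] by auto
  qed
  have Bt: "B t = convex_hull_measures \<Omega> (?Ex t)" by (simp add: B_def dipk_belief_def t)
  have "?L \<le> measure P A" "measure P A \<le> ?R" if "P \<in> B t" for P
    using convex_hull_measures_bounds[OF that[unfolded Bt] \<open>A \<subseteq> \<Omega>\<close> Q] by auto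
  then have "?L \<le> lower_prob (B t) A" "upper_prob (B t) A \<le> ?R"
    unfolding lower_prob_def upper_prob_def
    using ne by (auto intro: cINF_greatest cSUP_least)
  then show ?thesis
    using assms(16) by (auto simp: dipk_sure_loss_def t)
qed

end
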